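(* Let $D\subset\mathbb{R}$ be open, let $z\in D$ be a simple zero of a function $f:D\to\mathbb{R}$ that is sufficiently smooth in a neighborhood of $z$, and let $j\ge 0$ be a fixed integer. Let $\phi$ be a real function, sufficiently smooth in a neighborhood of $z$, whose derivatives satisfy the $j+1$ equalities $$\phi^{(i)}(z)=\frac{f^{(i+1)}(z)}{i+1},\qquad i=0,1,\ldots,j .$$ Then, for any initial value $x_0$ sufficiently close to $z$, the iterative process $x_{k+1}=t(x_k)$, $k=0,1,\ldots$, with $$t(x)=x-[\phi(x)]^{-1}f(x),$$ converges to $z$, and its order of convergence is at least $j+2$.
   Context: Notation: $g^{(i)}$ is the $i$-th derivative of $g$, with $g^{(0)}=g$; $[\phi(x)]^{-1}=1/\phi(x)$ is the reciprocal. A zero $z$ of $f$ is simple if $f(z)=0$ and $f^{(1)}(z)\ne0$. "Sufficiently smooth" means having as many continuous derivatives near $z$ as needed (read it as $C^\infty$ in a neighborhood of $z$). Order of convergence: a map $t$ with $t(z)=z$ (or the iterative process it generates) has order of convergence $p\ge 1$ at $z$ if $\lim_{x\to z}|z-t(x)|/|z-x|^p=c$ for some constant $c>0$. "Order of convergence at least $q$" means that there are a constant $C\ge0$ and a neighborhood of $z$ on which $t$ is defined and $|t(x)-z|\le C|x-z|^{q}$. *)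

theory Defs
  imports "HOL-Analysis.Analysis"
begin

text \<open>
  A partial real function with domain \<open>A\<close> is represented by a total function together with \<open>A\<close>.
  Its values outside \<open>A\<close> are unconstrained. The \<open>i\<close>-th derivative is \<open>(deriv ^^ i) g\<close>; at interior
  points of \<open>A\<close> it depends only on the values of \<open>g\<close> on \<open>A\<close>.
\<close>

text \<open>
  Smoothness means \<open>C\<^sup>\<infinity>\<close> on an open neighbourhood of \<open>z\<close> inside the domain. Continuity
  of every derivative is implied, since each derivative is again differentiable.
\<close>

definition smooth_near :: "real set \<Rightarrow> (real \<Rightarrow> real) \<Rightarrow> real \<Rightarrow> bool" where
  "smooth_near A g z \<longleftrightarrow>
     (\<exists>U. open U \<and> z \<in> U \<and> U \<subseteq> A \<and> (\<forall>n. \<forall>x\<in>U. (deriv ^^ n) g differentiable at x))"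

definition simple_zero :: "(real \<Rightarrow> real) \<Rightarrow> real \<Rightarrow> bool" where
  "simple_zero f z \<longleftrightarrow> f z = 0 \<and> deriv f z \<noteq> 0"

definition iter_map :: "(real \<Rightarrow> real) \<Rightarrow> (real \<Rightarrow> real) \<Rightarrow> real \<Rightarrow> real" where
  "iter_map f \<phi> x = x - inverse (\<phi> x) * f x"

text \<open>
  HOL sets \<open>inverse 0 = 0\<close>, so the points at which the map is actually defined are
  recorded explicitly (\<open>D\<close> and \<open>E\<close> are the domains of \<open>f\<close> and \<open>\<phi>\<close>).
\<close>

definition iter_map_domain :: "real set \<Rightarrow> real set \<Rightarrow> (real \<Rightarrow> real) \<Rightarrow> real set" where
  "iter_map_domain D E \<phi> = {x \<in> D \<inter> E. \<phi> x \<noteq> 0}"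

definition convergence_order_at_least ::
    "real set \<Rightarrow> (real \<Rightarrow> real) \<Rightarrow> real \<Rightarrow> nat \<Rightarrow> bool" where
  "convergence_order_at_least T t z q \<longleftrightarrow>
     t z = z \<and>
     (\<exists>C\<ge>0. \<exists>U. open U \<and> z \<in> U \<and> U \<subseteq> T \<and> (\<forall>x\<in>U. \<bar>t x - z\<bar> \<le> C * \<bar>x - z\<bar> ^ q))"

end

theory Submission
  imports Defs
begin

text \<open>
  Writing \<open>t x - z = ((x - z) * \<phi> x - f x) / \<phi> x\<close>, the hypotheses on the derivatives of \<open>\<phi>\<close> say
  exactly that the Taylor polynomial of \<open>f\<close> of degree \<open>j + 1\<close> at \<open>z\<close> is \<open>x - z\<close> times the Taylor
  polynomial of \<open>\<phi>\<close> of degree \<open>j\<close>. So the numerator is \<open>O((x - z) ^ (j + 2))\<close>, while the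
  denominator stays away from \<open>0\<close> because \<open>\<phi> z = deriv f z\<close>. Convergence of the iteration follows,
  since a map of order at least 2 halves the distance to \<open>z\<close> near \<open>z\<close>.
\<close>

lemma smooth_near_isCont:
  assumes "smooth_near A g z"
  shows "isCont g z"
proof -
  obtain U where "z \<in> U" "\<forall>n. \<forall>x\<in>U. (deriv ^^ n) g differentiable at x"
    using assms unfolding smooth_near_def by auto
  then have "(deriv ^^ 0) g differentiable at z" by blast
  then show ?thesis by (simp add: differentiable_imp_continuous_within)
qed

text \<open>The Lagrange remainder is \<open>(deriv ^^ n) g t / fact n * (x - z) ^ n\<close> with
  \<open>t\<close> between \<open>z\<close> and \<open>x\<close>; the derivative in it is
  continuous, hence bounded on a compact ball around \<open>z\<close>, which gives a constant
  uniform in \<open>x\<close>.\<close>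

lemma smooth_near_taylor_bound:
  assumes "smooth_near A g z" and "n > 0"
  obtains C d where "C \<ge> 0" "d > 0" "ball z d \<subseteq> A"
    "\<And>x. x \<in> ball z d \<Longrightarrow>
      \<bar>g x - (\<Sum>m<n. (deriv ^^ m) g z / fact m * (x - z) ^ m)\<bar> \<le> C * \<bar>x - z\<bar> ^ n"
proof -
  obtain U where U: "open U" "z \<in> U" "U \<subseteq> A"
    and diff: "\<And>n x. x \<in> U \<Longrightarrow> (deriv ^^ n) g differentiable at x"
    using assms(1) unfolding smooth_near_def by auto
  \<comment> \<open>The closed ball serves twice: it is compact, and it is the interval from
    \<open>z - d\<close> to \<open>z + d\<close> to which \<open>Taylor\<close> is applied.\<close>
  obtain d where d: "d > 0" "cball z d \<subseteq> U"
    using U open_contains_cball by blast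
  have der: "DERIV ((deriv ^^ m) g) t :> (deriv ^^ Suc m) g t" if "t \<in> cball z d" for m t
    using diff[of t m] that d(2)
    by (auto simp: DERIV_deriv_iff_real_differentiable)
  have "continuous_on (cball z d) ((deriv ^^ n) g)"
    using der by (meson DERIV_isCont continuous_at_imp_continuous_on)
  then have "bounded ((deriv ^^ n) g ` cball z d)"
    by (intro compact_imp_bounded compact_continuous_image) auto
  then obtain B where B: "B > 0" "\<And>t. t \<in> cball z d \<Longrightarrow> \<bar>(deriv ^^ n) g t\<bar> \<le> B"
    unfolding bounded_pos by auto
  have "\<bar>g x - (\<Sum>m<n. (deriv ^^ m) g z / fact m * (x - z) ^ m)\<bar> \<le> B / fact n * \<bar>x - z\<bar> ^ n"
    if x: "x \<in> ball z d" for x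
  proof (cases "x = z")
    \<comment> \<open>\<open>Taylor\<close> excludes the centre. There only the term
      \<open>m = 0\<close> survives, with \<open>0 ^ 0 = 1\<close>, and the right-hand side is 0
      because \<open>n > 0\<close>.\<close>
    case True
    obtain k where "n = Suc k" using assms(2) by (cases n) auto
    then show ?thesis using True by (simp add: sum.lessThan_Suc_shift)
  next
    case False
    have "\<exists>t. (if x < z then x < t \<and> t < z else z < t \<and> t < x) \<and>
        g x = (\<Sum>m<n. (deriv ^^ m) g z / fact m * (x - z) ^ m)
          + (deriv ^^ n) g t / fact n * (x - z) ^ n"
      using assms(2) False x d(1) der
      by (intro Taylor[where a = "z - d" and b = "z + d"]) (auto simp: dist_real_def)
    then obtain t where t: "if x < z then x < t \<and> t < z else z < t \<and> t < x"
      and eq: "g x = (\<Sum>m<n. (deriv ^^ m) g z / fact m * (x - z) ^ m)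
          + (deriv ^^ n) g t / fact n * (x - z) ^ n"
      by blast
    have "t \<in> cball z d"
      using t x by (auto simp: dist_real_def split: if_splits)
    then have "\<bar>(deriv ^^ n) g t\<bar> / fact n * \<bar>x - z\<bar> ^ n \<le> B / fact n * \<bar>x - z\<bar> ^ n"
      by (intro mult_right_mono divide_right_mono B) auto
    then show ?thesis
      by (simp add: eq abs_mult power_abs)
  qed
  moreover have "ball z d \<subseteq> A" using d(2) U(3) ball_subset_cball by blast
  ultimately show ?thesis
    using that[of "B / fact n" d] B(1) d(1) by simp
qed

lemma convergence_order_at_least_imp_converges:
  assumes "convergence_order_at_least T t z q" and "q \<ge> 2"
  obtains \<delta> where "\<delta> > 0"
    "\<And>x k. \<bar>x - z\<bar> < \<delta> \<Longrightarrow> (t ^^ k) x \<in> T"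
    "\<And>x. \<bar>x - z\<bar> < \<delta> \<Longrightarrow> (\<lambda>k. (t ^^ k) x) \<longlonglongrightarrow> z"
proof -
  obtain C U where C: "C \<ge> 0" and U: "open U" "z \<in> U" "U \<subseteq> T"
    and bound: "\<And>x. x \<in> U \<Longrightarrow> \<bar>t x - z\<bar> \<le> C * \<bar>x - z\<bar> ^ q"
    using assms(1) unfolding convergence_order_at_least_def by blast
  obtain e where e: "e > 0" "ball z e \<subseteq> U"
    using U open_contains_ball by blast
  \<comment> \<open>\<open>e\<close> keeps points inside \<open>U\<close>, 1 allows the exponent
    \<open>q\<close> to be lowered to 2, and the last bound gives
    \<open>C * \<delta> \<le> 1 / 2\<close>; the summand 1 in its denominator covers
    \<open>C = 0\<close>.\<close>
  define \<delta> where "\<delta> = min e (min 1 (1 / (2 * C + 1)))"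
  have \<delta>: "\<delta> > 0" "\<delta> \<le> e" "\<delta> \<le> 1" "\<delta> \<le> 1 / (2 * C + 1)"
    using C e(1) by (auto simp: \<delta>_def min_le_iff_disj)
  have "C * \<delta> \<le> C * (1 / (2 * C + 1))"
    using \<delta>(4) C by (rule mult_left_mono)
  also have "\<dots> \<le> 1 / 2"
    using C by (simp add: field_simps)
  finally have C\<delta>: "C * \<delta> \<le> 1 / 2" .
  have in_U: "x \<in> U" if "\<bar>x - z\<bar> < \<delta>" for x
    using that e(2) \<delta>(2) by (auto simp: dist_real_def subset_iff)
  have half: "\<bar>t x - z\<bar> \<le> 1 / 2 * \<bar>x - z\<bar>" if x: "\<bar>x - z\<bar> < \<delta>" for x
  proof -
    have "\<bar>t x - z\<bar> \<le> C * \<bar>x - z\<bar> ^ q" using bound in_U x by blast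
    also have "\<dots> \<le> C * \<bar>x - z\<bar> ^ 2"
      using C \<delta>(3) x assms(2) by (intro mult_left_mono power_decreasing) auto
    also have "\<dots> \<le> C * (\<delta> * \<bar>x - z\<bar>)"
      unfolding power2_eq_square using C x by (intro mult_left_mono mult_right_mono) auto
    also have "\<dots> = C * \<delta> * \<bar>x - z\<bar>" by simp
    also have "\<dots> \<le> 1 / 2 * \<bar>x - z\<bar>" using C\<delta> by (rule mult_right_mono) simp
    finally show ?thesis .
  qed
  \<comment> \<open>The second conjunct is carried along because \<open>half\<close> applies only
    within distance \<delta> of \<open>z\<close>; it also keeps the whole orbit in
    \<open>T\<close>.\<close>
  have iter: "\<bar>(t ^^ k) x - z\<bar> \<le> (1 / 2) ^ k * \<bar>x - z\<bar> \<and> \<bar>(t ^^ k) x - z\<bar> < \<delta>"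
    if x: "\<bar>x - z\<bar> < \<delta>" for x k
  proof (induction k)
    case 0
    then show ?case using x by simp
  next
    case (Suc k)
    then have half_step: "\<bar>(t ^^ Suc k) x - z\<bar> \<le> 1 / 2 * \<bar>(t ^^ k) x - z\<bar>"
      using half by simp
    also have "\<dots> \<le> \<bar>(t ^^ k) x - z\<bar>" by simp
    finally have "\<bar>(t ^^ Suc k) x - z\<bar> \<le> \<bar>(t ^^ k) x - z\<bar>" .
    with half_step show ?case using Suc by simp
  qed
  show ?thesis
  proof
    show "\<delta> > 0" by (fact \<delta>(1))
    show "(t ^^ k) x \<in> T" if "\<bar>x - z\<bar> < \<delta>" for x k
      using iter[OF that, of k] in_U U(3) by blast
    show "(\<lambda>k. (t ^^ k) x) \<longlonglongrightarrow> z" if x: "\<bar>x - z\<bar> < \<delta>" for x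
    proof -
      have "(\<lambda>k. (1 / 2) ^ k * \<bar>x - z\<bar>) \<longlonglongrightarrow> 0"
        by (intro tendsto_mult_left_zero LIMSEQ_power_zero) simp
      then have "(\<lambda>k. (t ^^ k) x - z) \<longlonglongrightarrow> 0"
        by (rule Lim_null_comparison[rotated]) (use iter[OF x] in auto)
      then show ?thesis by (simp add: LIM_zero_iff)
    qed
  qed
qed

lemma iter_map_convergence_order:
  fixes f \<phi> :: "real \<Rightarrow> real"
  assumes zero: "simple_zero f z"
    and f: "smooth_near D f z"
    and \<phi>: "smooth_near E \<phi> z"
    and eq: "\<And>i. i \<le> j \<Longrightarrow> (deriv ^^ i) \<phi> z = (deriv ^^ (i + 1)) f z / (real i + 1)"
  shows "convergence_order_at_least (iter_map_domain D E \<phi>) (iter_map f \<phi>) z (j + 2)"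
proof -
  \<comment> \<open>\<open>P\<close> stops at degree \<open>j\<close>: its error has order
    \<open>j + 1\<close>, and the factor \<open>x - z\<close> in the numerator supplies the missing
    power.\<close>
  define P where "P x = (\<Sum>m<j + 1. (deriv ^^ m) \<phi> z / fact m * (x - z) ^ m)" for x
  obtain C1 d1 where C1: "C1 \<ge> 0" "d1 > 0" "ball z d1 \<subseteq> D"
    and f_bound: "\<And>x. x \<in> ball z d1 \<Longrightarrow>
      \<bar>f x - (\<Sum>m<j + 2. (deriv ^^ m) f z / fact m * (x - z) ^ m)\<bar> \<le> C1 * \<bar>x - z\<bar> ^ (j + 2)"
    using smooth_near_taylor_bound[OF f, of "j + 2"] by auto
  obtain C2 d2 where C2: "C2 \<ge> 0" "d2 > 0" "ball z d2 \<subseteq> E"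
    and \<phi>_bound: "\<And>x. x \<in> ball z d2 \<Longrightarrow> \<bar>\<phi> x - P x\<bar> \<le> C2 * \<bar>x - z\<bar> ^ (j + 1)"
    using smooth_near_taylor_bound[OF \<phi>, of "j + 1"] unfolding P_def by auto
  have f0: "f z = 0" and \<phi>0: "\<phi> z \<noteq> 0"
    using zero eq[of 0] by (auto simp: simple_zero_def)
  \<comment> \<open>The constant term drops out since \<open>f z = 0\<close>. After the index shift,
    dividing the hypothesis by \<open>fact m\<close> turns the factor \<open>m + 1\<close> into
    \<open>fact (Suc m)\<close>, so the coefficients agree for all \<open>m \<le> j\<close>.\<close>
  have f_poly: "(\<Sum>m<j + 2. (deriv ^^ m) f z / fact m * (x - z) ^ m) = (x - z) * P x" for x
  proof -
    have "(\<Sum>m<j + 2. (deriv ^^ m) f z / fact m * (x - z) ^ m)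
        = (\<Sum>m<j + 1. (deriv ^^ Suc m) f z / fact (Suc m) * (x - z) ^ Suc m)"
      using f0 by (simp add: sum.lessThan_Suc_shift del: sum.lessThan_Suc)
    also have "\<dots> = (\<Sum>m<j + 1. (x - z) * ((deriv ^^ m) \<phi> z / fact m * (x - z) ^ m))"
    proof (rule sum.cong)
      fix m assume "m \<in> {..<j + 1}"
      then have "(deriv ^^ Suc m) f z = (real m + 1) * (deriv ^^ m) \<phi> z"
        using eq[of m] by simp
      moreover have "fact (Suc m) = (real m + 1) * fact m" by (simp add: add.commute)
      moreover have "real m + 1 \<noteq> 0" by linarith
      ultimately have "(deriv ^^ Suc m) f z / fact (Suc m) = (deriv ^^ m) \<phi> z / fact m"
        by (simp only: mult_divide_mult_cancel_left not_False_eq_True)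
      then show "(deriv ^^ Suc m) f z / fact (Suc m) * (x - z) ^ Suc m
          = (x - z) * ((deriv ^^ m) \<phi> z / fact m * (x - z) ^ m)"
        by (simp only: power_Suc mult.left_commute)
    qed simp
    finally show ?thesis by (simp only: P_def sum_distrib_left)
  qed
  have "\<forall>\<^sub>F x in nhds z. \<bar>\<phi> z\<bar> / 2 < \<bar>\<phi> x\<bar>"
  proof (rule order_tendstoD(1))
    show "((\<lambda>x. \<bar>\<phi> x\<bar>) \<longlongrightarrow> \<bar>\<phi> z\<bar>) (nhds z)"
      using smooth_near_isCont[OF \<phi>] by (intro tendsto_rabs)
        (simp add: continuous_at tendsto_at_iff_tendsto_nhds)
  qed (use \<phi>0 in simp)
  then obtain V where V: "open V" "z \<in> V" "\<And>x. x \<in> V \<Longrightarrow> \<bar>\<phi> z\<bar> / 2 < \<bar>\<phi> x\<bar>"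
    unfolding eventually_nhds by auto
  define U where "U = V \<inter> ball z d1 \<inter> ball z d2"
  \<comment> \<open>The numerator contributes \<open>C1 + C2\<close>, one constant for each Taylor
    remainder; the divisor is the lower bound for \<open>\<bar>\<phi> x\<bar>\<close> on
    \<open>V\<close>.\<close>
  define C where "C = (C1 + C2) / (\<bar>\<phi> z\<bar> / 2)"
  have "\<bar>iter_map f \<phi> x - z\<bar> \<le> C * \<bar>x - z\<bar> ^ (j + 2)" if x: "x \<in> U" for x
  proof -
    have large: "\<bar>\<phi> z\<bar> / 2 < \<bar>\<phi> x\<bar>" using V(3) x by (simp add: U_def)
    then have "\<phi> x \<noteq> 0" by auto
    then have "iter_map f \<phi> x - z = ((x - z) * \<phi> x - f x) / \<phi> x"
      by (simp add: iter_map_def field_simps)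
    \<comment> \<open>Inserting \<open>(x - z) * P x\<close> splits the numerator into the two
      Taylor remainders.\<close>
    also have "(x - z) * \<phi> x - f x = (x - z) * (\<phi> x - P x) - (f x - (x - z) * P x)"
      by (simp add: algebra_simps)
    finally have "\<bar>iter_map f \<phi> x - z\<bar>
        = \<bar>(x - z) * (\<phi> x - P x) - (f x - (x - z) * P x)\<bar> / \<bar>\<phi> x\<bar>"
      by simp
    also have "\<dots> \<le> (C1 + C2) * \<bar>x - z\<bar> ^ (j + 2) / (\<bar>\<phi> z\<bar> / 2)"
    proof (rule frac_le)
      have "\<bar>(x - z) * (\<phi> x - P x)\<bar> \<le> \<bar>x - z\<bar> * (C2 * \<bar>x - z\<bar> ^ (j + 1))"
        unfolding abs_mult using \<phi>_bound x by (intro mult_left_mono) (auto simp: U_def)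
      also have "\<dots> = C2 * \<bar>x - z\<bar> ^ (j + 2)" by simp
      finally have "\<bar>(x - z) * (\<phi> x - P x)\<bar> \<le> C2 * \<bar>x - z\<bar> ^ (j + 2)" .
      moreover have "\<bar>f x - (x - z) * P x\<bar> \<le> C1 * \<bar>x - z\<bar> ^ (j + 2)"
        using f_bound[of x] x by (simp only: f_poly) (auto simp: U_def)
      ultimately show "\<bar>(x - z) * (\<phi> x - P x) - (f x - (x - z) * P x)\<bar>
          \<le> (C1 + C2) * \<bar>x - z\<bar> ^ (j + 2)"
        using abs_triangle_ineq4[of "(x - z) * (\<phi> x - P x)" "f x - (x - z) * P x"]
        unfolding distrib_right by linarith
    qed (use large \<phi>0 C1 C2 in auto)
    finally show ?thesis by (simp only: C_def times_divide_eq_left)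
  qed
  moreover have "C \<ge> 0" "open U" "z \<in> U" "iter_map f \<phi> z = z"
    using C1 C2 V f0 by (auto simp: C_def U_def iter_map_def)
  \<comment> \<open>The lower bound on \<open>\<bar>\<phi> x\<bar>\<close> excludes zeros of \<phi>
    from \<open>U\<close>, so the estimate never relies on the default
    \<open>inverse 0 = 0\<close>.\<close>
  moreover have "U \<subseteq> iter_map_domain D E \<phi>"
    using V(3) C1(3) C2(3) by (force simp: U_def iter_map_domain_def)
  ultimately show ?thesis
    unfolding convergence_order_at_least_def by blast
qed

theorem proposition2p1:
  fixes D E :: "real set" and f \<phi> :: "real \<Rightarrow> real" and z :: real and j :: nat
  assumes "open D" and "z \<in> D"
    and "simple_zero f z"
    and "smooth_near D f z"
    and "smooth_near E \<phi> z"
    and "\<And>i. i \<le> j \<Longrightarrow> (deriv ^^ i) \<phi> z = (deriv ^^ (i + 1)) f z / (real i + 1)"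
  shows "(\<exists>\<delta>>0. \<forall>x0. \<bar>x0 - z\<bar> < \<delta> \<longrightarrow>
            (\<forall>k. (iter_map f \<phi> ^^ k) x0 \<in> iter_map_domain D E \<phi>) \<and>
            (\<lambda>k. (iter_map f \<phi> ^^ k) x0) \<longlonglongrightarrow> z) \<and>
         convergence_order_at_least (iter_map_domain D E \<phi>) (iter_map f \<phi>) z (j + 2)"
proof -
  have order: "convergence_order_at_least (iter_map_domain D E \<phi>) (iter_map f \<phi>) z (j + 2)"
    using assms(3-6) by (rule iter_map_convergence_order)
  \<comment> \<open>Even for \<open>j = 0\<close> the order \<open>j + 2\<close> is at least 2, as
    the contraction argument requires.\<close>
  obtain \<delta> where "\<delta> > 0"
    "\<And>x k. \<bar>x - z\<bar> < \<delta> \<Longrightarrow> (iter_map f \<phi> ^^ k) x \<in> iter_map_domain D E \<phi>"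
    "\<And>x. \<bar>x - z\<bar> < \<delta> \<Longrightarrow> (\<lambda>k. (iter_map f \<phi> ^^ k) x) \<longlonglongrightarrow> z"
    using convergence_order_at_least_imp_converges[OF order] by auto
  with order show ?thesis by blast
qed

end
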